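(* Index rows and columns of the $5\times5$ grid by $0,1,2,3,4$, and let $$\mathcal A_5=\{(0,j),(j,0),(j,j):1\le j\le4\},$$ $$\mathcal B_5=\{(0,0),(0,1),(0,2),(1,0),(1,3),(1,4),(2,1),(2,3),(3,1),(3,4),(4,2),(4,3)\}.$$ (a) There is no irreducible simple configuration with one-edge set $E_1=\mathcal B_5$ and exactly six two-edges (18 displayed squares). (b) Let $K$ be a set of six pairwise disjoint two-edges on the 13 cells not in $\mathcal A_5$, with $K\ne\mathcal F_+$ and $K\neq\mathcal F_-$, where $$\mathcal F_+=\{u_{12}+u_{34},\,u_{13}+u_{42},\,u_{14}+u_{23},\,u_{21}+u_{43},\,u_{24}+u_{31},\,u_{32}+u_{41}\},$$ $$\mathcal F_-=\{u_{12}+u_{43},\,u_{13}+u_{24},\,u_{14}+u_{32},\,u_{21}+u_{34},\,u_{23}+u_{41},\,u_{31}+u_{42}\}.$$ Then the 18-square configuration with one-edges $\mathcal A_5$ and two-edges $K$ is excluded by (hence is reducible because of) a strip overload, a product relation, or an instance of one of the local identities (S), (E), as defined in the context.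
   Context: The cell $(i,j)$ is identified with the monomial $u_{ij}=x_iy_j$ in real variables. A one-edge is a single cell; a two-edge is an unordered pair of distinct cells (possibly in a common row or column), written $u_{ij}+u_{k\ell}$ for $\{(i,j),(k,\ell)\}$. A configuration $G$ consists of a set $E_1$ of one-edges and a set $E_2$ of two-edges; it is simple if distinct selected edges have disjoint supports. Its displayed forms are $u_{ij}$ for each one-edge and $u_{ij}+u_{k\ell}$ for each two-edge; $P_G$ is the sum of the squares of the displayed forms and $R(G)=|E_1|+|E_2|$. $G$ is irreducible if $P_G$ cannot be written as a sum of fewer than $R(G)$ squares of real bilinear forms (real linear combinations of the $u_{ij}$), and reducible otherwise. Strip overload: for some $q$, there are two rows and $q$ columns (or $q$ rows and two columns) such that more than $q+1$ of the selected edges have all their cells in those rows and columns. Product relation: the displayed forms $f_1,\dots,f_R$ satisfy $\sum_{a<b}c_{ab}f_af_b=0$ as polynomials for some real coefficients $c_{ab}$, not all zero. Instance of a local identity: for some pairwise distinct rows $x,y,z$ and pairwise distinct columns $a,b,c,d$ (only those occurring), where $xa$ denotes the monomial of the cell in row $x$ and column $a$, all the squares on the left-hand side of one of the following identities are displayed squares of the configuration: (S) $(xb+za)^2+(ya+zd)^2+(xd)^2+(yb)^2+(yd)^2=(xb+yd+za)^2+(xd-yb)^2+(ya)^2+(zd)^2$; (E) $(xa)^2+(zc)^2+(ya)^2+(yb)^2+(zb)^2+(xc+zd)^2+(xd+za)^2=(xc)^2+(ya+zb)^2+(yb-za)^2+(xd+zc)^2+(xa+zd)^2$. *)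

theory Defs
  imports Complex_Main "HOL-Library.Disjoint_Sets"
begin

text \<open>
  A real polynomial in the variables \<open>x\<^sub>i, y\<^sub>j\<close> is represented by the function of the two
  real vectors \<open>x, y\<close> that it induces; over the infinite field of the reals, equality of
  polynomials is equality of these functions.
\<close>

type_synonym cell = "nat \<times> nat"
type_synonym xy_poly = "(nat \<Rightarrow> real) \<Rightarrow> (nat \<Rightarrow> real) \<Rightarrow> real"

definition grid :: "nat \<Rightarrow> nat \<Rightarrow> cell set" where
  "grid m n = {..<m} \<times> {..<n}"

definition cell_monomial :: "cell \<Rightarrow> xy_poly" where
  "cell_monomial c x y = x (fst c) * y (snd c)"

definition bilinear_form :: "nat \<Rightarrow> nat \<Rightarrow> xy_poly \<Rightarrow> bool" where
  "bilinear_form m n f \<longleftrightarrow>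
     (\<exists>A :: cell \<Rightarrow> real. \<forall>x y. f x y = (\<Sum>c\<in>grid m n. A c * cell_monomial c x y))"

text \<open>
  A configuration on the \<open>m \<times> n\<close> grid is given by its set \<open>E1\<close> of one-edges (cells) and its
  set \<open>E2\<close> of two-edges (two-element sets of cells).  As a selected edge, a one-edge \<open>c\<close>
  is the singleton \<open>{c}\<close>, so that every selected edge is its own support.
\<close>

definition configuration :: "nat \<Rightarrow> nat \<Rightarrow> cell set \<Rightarrow> cell set set \<Rightarrow> bool" where
  "configuration m n E1 E2 \<longleftrightarrow>
     E1 \<subseteq> grid m n \<and> (\<forall>e\<in>E2. e \<subseteq> grid m n \<and> card e = 2)"

definition selected_edges :: "cell set \<Rightarrow> cell set set \<Rightarrow> cell set set" where
  "selected_edges E1 E2 = (\<lambda>c. {c}) ` E1 \<union> E2"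

definition simple_configuration :: "nat \<Rightarrow> nat \<Rightarrow> cell set \<Rightarrow> cell set set \<Rightarrow> bool" where
  "simple_configuration m n E1 E2 \<longleftrightarrow>
     configuration m n E1 E2 \<and> disjoint (selected_edges E1 E2)"

definition edge_form :: "cell set \<Rightarrow> xy_poly" where
  "edge_form e x y = (\<Sum>c\<in>e. cell_monomial c x y)"

definition P_config :: "cell set \<Rightarrow> cell set set \<Rightarrow> xy_poly" where
  "P_config E1 E2 x y = (\<Sum>e\<in>selected_edges E1 E2. (edge_form e x y)\<^sup>2)"

definition R_config :: "cell set \<Rightarrow> cell set set \<Rightarrow> nat" where
  "R_config E1 E2 = card E1 + card E2"

definition reducible_config :: "nat \<Rightarrow> nat \<Rightarrow> cell set \<Rightarrow> cell set set \<Rightarrow> bool" where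
  "reducible_config m n E1 E2 \<longleftrightarrow>
     (\<exists>r < R_config E1 E2. \<exists>g :: nat \<Rightarrow> xy_poly.
        (\<forall>k<r. bilinear_form m n (g k)) \<and>
        (\<forall>x y. P_config E1 E2 x y = (\<Sum>k<r. (g k x y)\<^sup>2)))"

definition irreducible_config :: "nat \<Rightarrow> nat \<Rightarrow> cell set \<Rightarrow> cell set set \<Rightarrow> bool" where
  "irreducible_config m n E1 E2 \<longleftrightarrow> \<not> reducible_config m n E1 E2"

definition strip_overload :: "nat \<Rightarrow> nat \<Rightarrow> cell set \<Rightarrow> cell set set \<Rightarrow> bool" where
  "strip_overload m n E1 E2 \<longleftrightarrow>
     (\<exists>q rows cols. rows \<subseteq> {..<m} \<and> cols \<subseteq> {..<n} \<and>
        (card rows = 2 \<and> card cols = q \<or> card rows = q \<and> card cols = 2) \<and>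
        card {e \<in> selected_edges E1 E2. e \<subseteq> rows \<times> cols} > q + 1)"

text \<open>The list \<open>es\<close> enumerates the selected edges; the property does not depend on its order.\<close>

definition product_relation :: "cell set \<Rightarrow> cell set set \<Rightarrow> bool" where
  "product_relation E1 E2 \<longleftrightarrow>
     (\<exists>es (c :: nat \<Rightarrow> nat \<Rightarrow> real).
        distinct es \<and> set es = selected_edges E1 E2 \<and>
        (\<exists>b < length es. \<exists>a < b. c a b \<noteq> 0) \<and>
        (\<forall>x y. (\<Sum>b < length es. \<Sum>a < b.
                  c a b * edge_form (es ! a) x y * edge_form (es ! b) x y) = 0))"

text \<open>
  The local identities.  The definitions after each identity say that all the forms squared
  on its left-hand side are displayed forms.
\<close>

lemma local_identity_S:
  fixes X Y :: "nat \<Rightarrow> real" and x y z a b d :: nat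
  defines "v \<equiv> \<lambda>i j. cell_monomial (i, j) X Y"
  shows "(v x b + v z a)\<^sup>2 + (v y a + v z d)\<^sup>2 + (v x d)\<^sup>2 + (v y b)\<^sup>2 + (v y d)\<^sup>2 =
         (v x b + v y d + v z a)\<^sup>2 + (v x d - v y b)\<^sup>2 + (v y a)\<^sup>2 + (v z d)\<^sup>2"
  unfolding v_def cell_monomial_def by (simp add: power2_eq_square algebra_simps)

definition instance_S :: "cell set \<Rightarrow> cell set set \<Rightarrow> bool" where
  "instance_S E1 E2 \<longleftrightarrow>
     (\<exists>x y z a b d. distinct [x, y, z] \<and> distinct [a, b, d] \<and>
        {{(x, b), (z, a)}, {(y, a), (z, d)}} \<subseteq> E2 \<and>
        {(x, d), (y, b), (y, d)} \<subseteq> E1)"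

lemma local_identity_E:
  fixes X Y :: "nat \<Rightarrow> real" and x y z a b c d :: nat
  defines "v \<equiv> \<lambda>i j. cell_monomial (i, j) X Y"
  shows "(v x a)\<^sup>2 + (v z c)\<^sup>2 + (v y a)\<^sup>2 + (v y b)\<^sup>2 + (v z b)\<^sup>2
           + (v x c + v z d)\<^sup>2 + (v x d + v z a)\<^sup>2 =
         (v x c)\<^sup>2 + (v y a + v z b)\<^sup>2 + (v y b - v z a)\<^sup>2 + (v x d + v z c)\<^sup>2 + (v x a + v z d)\<^sup>2"
  unfolding v_def cell_monomial_def by (simp add: power2_eq_square algebra_simps)

definition instance_E :: "cell set \<Rightarrow> cell set set \<Rightarrow> bool" where
  "instance_E E1 E2 \<longleftrightarrow>
     (\<exists>x y z a b c d. distinct [x, y, z] \<and> distinct [a, b, c, d] \<and>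
        {(x, a), (z, c), (y, a), (y, b), (z, b)} \<subseteq> E1 \<and>
        {{(x, c), (z, d)}, {(x, d), (z, a)}} \<subseteq> E2)"

definition excluded :: "nat \<Rightarrow> nat \<Rightarrow> cell set \<Rightarrow> cell set set \<Rightarrow> bool" where
  "excluded m n E1 E2 \<longleftrightarrow>
     strip_overload m n E1 E2 \<or> product_relation E1 E2 \<or> instance_S E1 E2 \<or> instance_E E1 E2"

definition A5 :: "cell set" where
  "A5 = (\<Union>j\<in>{1..4}. {(0, j), (j, 0), (j, j)})"

definition B5 :: "cell set" where
  "B5 = {(0,0), (0,1), (0,2), (1,0), (1,3), (1,4), (2,1), (2,3), (3,1), (3,4), (4,2), (4,3)}"

definition F_plus :: "cell set set" where
  "F_plus = {{(1,2),(3,4)}, {(1,3),(4,2)}, {(1,4),(2,3)}, {(2,1),(4,3)}, {(2,4),(3,1)}, {(3,2),(4,1)}}"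

definition F_minus :: "cell set set" where
  "F_minus = {{(1,2),(4,3)}, {(1,3),(2,4)}, {(1,4),(3,2)}, {(2,1),(3,4)}, {(2,3),(4,1)}, {(3,1),(4,2)}}"

end

theory Submission
  imports Defs
begin

text \<open>
  If the squares of some of the selected edges have a sum of fewer squares, then so has the whole
  configuration.  Up to permutations of rows and columns and transposition, nine small sets of
  edges suffice.  Six of them carry a product relation in which the products have no factor in
  common, except for at most two that share one factor.  Adding \<open>2 t\<close> times the relation to the
  sum of the squares and completing squares saves a square, for \<open>t = 1\<close> if no factor is shared
  and for \<open>t = 1 / \<surd>2\<close> otherwise.  Two of them overload a strip of two rows, and the last one is
  the left-hand side of identity (S).  Every set of six disjoint two-edges on the 13 free cells
  contains the two-edges of one of these sets placed in the grid, or is one of the two exceptional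
  sets; a depth-first search with a few hundred nodes checks this.
\<close>

section \<open>Bilinear forms and subconfigurations\<close>

lemma finite_grid [simp]: "finite (grid m n)"
  by (simp add: grid_def)

text \<open>
  A set \<open>F\<close> of edges is treated as the configuration \<open>({}, F)\<close>; the singletons in \<open>F\<close> are its
  one-edges.
\<close>

lemma selected_edges_empty [simp]: "selected_edges {} F = F"
  by (simp add: selected_edges_def)

text \<open>Collecting terms by the fibres of \<open>h\<close> gives one coefficient per grid cell;
  \<open>h\<close> is later the identity or a placement.\<close>

lemma bilinear_form_sum_monomials:
  assumes "finite S" and "\<And>c. c \<in> S \<Longrightarrow> h c \<in> grid m n"
  shows "bilinear_form m n (\<lambda>x y. \<Sum>c\<in>S. A c * cell_monomial (h c) x y)"
  unfolding bilinear_form_def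
proof (intro exI allI)
  fix x y
  have "(\<Sum>c\<in>S. A c * cell_monomial (h c) x y)
      = (\<Sum>d\<in>grid m n. \<Sum>c\<in>{c \<in> S. h c = d}. A c * cell_monomial (h c) x y)"
    by (rule sum.group [symmetric]) (use assms in auto)
  also have "\<dots> = (\<Sum>d\<in>grid m n. (\<Sum>c\<in>{c \<in> S. h c = d}. A c) * cell_monomial d x y)"
    by (simp add: sum_distrib_right)
  finally show "(\<Sum>c\<in>S. A c * cell_monomial (h c) x y) = \<dots>" .
qed

lemma bilinear_form_monomial:
  assumes "i < m" "j < n"
  shows "bilinear_form m n (\<lambda>x y. x i * y j)"
  using bilinear_form_sum_monomials [of "{(i, j)}" "\<lambda>c. c" m n "\<lambda>_. 1"] assms
  by (simp add: grid_def cell_monomial_def)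

lemma bilinear_form_add:
  assumes "bilinear_form m n f" "bilinear_form m n g"
  shows "bilinear_form m n (\<lambda>x y. f x y + g x y)"
proof -
  from assms obtain A B where
    "\<And>x y. f x y = (\<Sum>c\<in>grid m n. A c * cell_monomial c x y)"
    "\<And>x y. g x y = (\<Sum>c\<in>grid m n. B c * cell_monomial c x y)"
    unfolding bilinear_form_def by blast
  then show ?thesis
    unfolding bilinear_form_def
    by (intro exI [of _ "\<lambda>c. A c + B c"]) (simp add: sum.distrib distrib_right)
qed

lemma bilinear_form_cmult:
  assumes "bilinear_form m n f"
  shows "bilinear_form m n (\<lambda>x y. a * f x y)"
proof -
  from assms obtain A where "\<And>x y. f x y = (\<Sum>c\<in>grid m n. A c * cell_monomial c x y)"
    unfolding bilinear_form_def by blast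
  then show ?thesis
    unfolding bilinear_form_def
    by (intro exI [of _ "\<lambda>c. a * A c"]) (simp add: sum_distrib_left mult.assoc)
qed

lemma bilinear_form_diff:
  assumes "bilinear_form m n f" "bilinear_form m n g"
  shows "bilinear_form m n (\<lambda>x y. f x y - g x y)"
  using bilinear_form_add [OF assms(1) bilinear_form_cmult [OF assms(2), of "-1"]] by simp

lemma bilinear_form_divide:
  assumes "bilinear_form m n f"
  shows "bilinear_form m n (\<lambda>x y. f x y / a)"
  using bilinear_form_cmult [OF assms, of "inverse a"] by (simp add: field_simps)

lemmas bilinear_form_intros =
  bilinear_form_add bilinear_form_diff bilinear_form_cmult bilinear_form_divide
  bilinear_form_monomial

lemma bilinear_form_edge:
  assumes "e \<subseteq> grid m n"
  shows "bilinear_form m n (edge_form e)"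
  using bilinear_form_sum_monomials [of e "\<lambda>c. c" m n "\<lambda>_. 1"] assms finite_subset [OF assms]
  by (auto simp: edge_form_def [abs_def])

text \<open>Lists of forms can be concatenated, when further edges are added, and mapped, when a
  pattern is placed in the grid.\<close>

lemma reducible_config_iff_list:
  "reducible_config m n E1 E2 \<longleftrightarrow>
    (\<exists>gs. length gs < R_config E1 E2 \<and> (\<forall>g\<in>set gs. bilinear_form m n g) \<and>
      (\<forall>x y. P_config E1 E2 x y = (\<Sum>g\<leftarrow>gs. (g x y)\<^sup>2)))" (is "_ \<longleftrightarrow> ?rhs")
proof
  assume "reducible_config m n E1 E2"
  then obtain r g where "r < R_config E1 E2" "\<forall>k<r. bilinear_form m n (g k)"
      "\<forall>x y. P_config E1 E2 x y = (\<Sum>k<r. (g k x y)\<^sup>2)"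
    unfolding reducible_config_def by blast
  then show ?rhs
    by (intro exI [of _ "map g [0..<r]"])
      (auto simp: interv_sum_list_conv_sum_set_nat atLeast0LessThan o_def)
next
  assume ?rhs
  then obtain gs where "length gs < R_config E1 E2" "\<forall>g\<in>set gs. bilinear_form m n g"
      "\<forall>x y. P_config E1 E2 x y = (\<Sum>g\<leftarrow>gs. (g x y)\<^sup>2)"
    by blast
  then show "reducible_config m n E1 E2"
    unfolding reducible_config_def
    by (intro exI [of _ "length gs"] conjI exI [of _ "(!) gs"])
      (auto simp: sum_list_sum_nth atLeast0LessThan)
qed

section \<open>Passing from some selected edges to all of them\<close>

lemma reducible_config_mono:
  assumes "reducible_config m n {} F" and F: "F \<subseteq> selected_edges E1 E2"
    and fin: "finite E1" "finite E2" and sub: "selected_edges E1 E2 \<subseteq> Pow (grid m n)"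
  shows "reducible_config m n E1 E2"
proof -
  let ?S = "selected_edges E1 E2"
  have finS: "finite ?S"
    using fin by (simp add: selected_edges_def)
  \<comment> \<open>A singleton in \<open>E2\<close> could coincide with a one-edge, so this is only
    an inequality; its direction is the one required.\<close>
  have "card ?S \<le> R_config E1 E2"
    unfolding selected_edges_def R_config_def
    by (rule order_trans [OF card_Un_le]) (simp add: card_image_le fin)
  moreover obtain gs where gs: "length gs < card F" "\<forall>g\<in>set gs. bilinear_form m n g"
      "\<And>x y. (\<Sum>e\<in>F. (edge_form e x y)\<^sup>2) = (\<Sum>g\<leftarrow>gs. (g x y)\<^sup>2)"
    using assms(1) by (auto simp: reducible_config_iff_list R_config_def P_config_def)
  moreover obtain es where es: "set es = ?S - F" "distinct es"
    using finS finite_distinct_list by blast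
  moreover have "length es + card F = card ?S"
    using es F finS by (metis add.commute card_Diff_subset card_mono distinct_card
        finite_subset le_add_diff_inverse)
  moreover have "(\<Sum>e\<in>?S. (edge_form e x y)\<^sup>2)
      = (\<Sum>g\<leftarrow>gs @ map edge_form es. (g x y)\<^sup>2)" for x y
    using sum.subset_diff [OF F finS, of "\<lambda>e. (edge_form e x y)\<^sup>2"]
      sum.distinct_set_conv_list [OF es(2), of "\<lambda>e. (edge_form e x y)\<^sup>2"]
    by (simp add: gs(3) es(1) o_def)
  ultimately show ?thesis
    unfolding reducible_config_iff_list P_config_def
    by (intro exI [of _ "gs @ map edge_form es"])
      (use sub in \<open>auto intro!: bilinear_form_edge\<close>)
qed

lemma strip_overload_mono:
  assumes "strip_overload m n {} F" and F: "F \<subseteq> selected_edges E1 E2"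
    and fin: "finite E1" "finite E2"
  shows "strip_overload m n E1 E2"
proof -
  obtain q R C where "R \<subseteq> {..<m}" "C \<subseteq> {..<n}" "card R = 2 \<and> card C = q \<or> card R = q \<and> card C = 2"
      "card {e \<in> F. e \<subseteq> R \<times> C} > q + 1"
    using assms(1) unfolding strip_overload_def by auto
  moreover have "card {e \<in> F. e \<subseteq> R \<times> C} \<le> card {e \<in> selected_edges E1 E2. e \<subseteq> R \<times> C}"
    by (rule card_mono) (use F fin in \<open>auto simp: selected_edges_def\<close>)
  ultimately show ?thesis
    unfolding strip_overload_def by (intro exI [of _ q] exI [of _ R] exI [of _ C]) auto
qed

lemma product_relation_mono:
  assumes "product_relation {} F" and F: "F \<subseteq> selected_edges E1 E2"
    and fin: "finite E1" "finite E2"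
  shows "product_relation E1 E2"
proof -
  obtain es c where es: "distinct es" "set es = F"
      and nz: "\<exists>b < length es. \<exists>a < b. c a b \<noteq> 0"
      and rel: "\<And>x y. (\<Sum>b < length es. \<Sum>a < b.
          c a b * edge_form (es ! a) x y * edge_form (es ! b) x y) = 0"
    using assms(1) by (auto simp: product_relation_def)
  obtain ds where ds: "distinct ds" "set ds = selected_edges E1 E2 - F"
    using fin finite_distinct_list [of "selected_edges E1 E2 - F"]
    by (auto simp: selected_edges_def)
  \<comment> \<open>The new edges come last, so a product involving one of them has its larger index
    \<open>b\<close> beyond \<open>es\<close> and gets coefficient 0.\<close>
  define c' where "c' a b = (if b < length es then c a b else 0)" for a b
  have "(\<Sum>b < length (es @ ds). \<Sum>a < b.
      c' a b * edge_form ((es @ ds) ! a) x y * edge_form ((es @ ds) ! b) x y)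
    = (\<Sum>b < length es. \<Sum>a < b. c a b * edge_form (es ! a) x y * edge_form (es ! b) x y)"
    for x y
    by (rule sum.mono_neutral_cong_right)
      (auto simp: c'_def nth_append intro!: sum.cong)
  moreover have "\<exists>b < length (es @ ds). \<exists>a < b. c' a b \<noteq> 0"
  proof -
    from nz obtain a b where "b < length es" "a < b" "c a b \<noteq> 0"
      by blast
    then show ?thesis
      by (intro exI [of _ b] conjI exI [of _ a]) (auto simp: c'_def)
  qed
  ultimately show ?thesis
    unfolding product_relation_def using es ds F rel
    by (intro exI [of _ "es @ ds"] exI [of _ c']) auto
qed

section \<open>Placing a pattern in the grid\<close>

text \<open>
  The placement of a small pattern into the grid: its row \<open>i\<close> becomes row \<open>rs ! i\<close> and its
  column \<open>j\<close> becomes column \<open>cs ! j\<close>, or, if \<open>t\<close> holds, the other way round.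
\<close>

definition move :: "bool \<Rightarrow> nat list \<Rightarrow> nat list \<Rightarrow> cell \<Rightarrow> cell" where
  "move t rs cs c = (if t then (cs ! snd c, rs ! fst c) else (rs ! fst c, cs ! snd c))"

context
  fixes n :: nat and rs cs :: "nat list" and t :: bool
  assumes distinct: "distinct rs" "distinct cs" and sub: "set rs \<subseteq> {..<n}" "set cs \<subseteq> {..<n}"
begin

lemma move_in_grid: "c \<in> grid (length rs) (length cs) \<Longrightarrow> move t rs cs c \<in> grid n n"
  using sub nth_mem by (fastforce simp: grid_def move_def)

lemma inj_on_move: "inj_on (move t rs cs) (grid (length rs) (length cs))"
  using distinct by (auto simp: inj_on_def grid_def move_def nth_eq_iff_index_eq)

text \<open>A placement is a substitution of variables, with \<open>x\<close> and \<open>y\<close>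
  exchanged for a transposition, so identities between forms carry over.\<close>

lemma edge_form_move:
  assumes "e \<subseteq> grid (length rs) (length cs)"
  shows "edge_form (move t rs cs ` e) x y
    = edge_form e (\<lambda>i. (if t then y else x) (rs ! i)) (\<lambda>j. (if t then x else y) (cs ! j))"
  unfolding edge_form_def
  by (subst sum.reindex [OF inj_on_subset [OF inj_on_move assms]])
    (auto simp: cell_monomial_def move_def intro!: sum.cong)

lemma bilinear_form_move:
  assumes "bilinear_form (length rs) (length cs) g"
  shows "bilinear_form n n
    (\<lambda>x y. g (\<lambda>i. (if t then y else x) (rs ! i)) (\<lambda>j. (if t then x else y) (cs ! j)))"
proof -
  let ?G = "grid (length rs) (length cs)"
  obtain A where A: "\<And>x y. g x y = (\<Sum>c\<in>?G. A c * cell_monomial c x y)"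
    using assms unfolding bilinear_form_def by blast
  have "bilinear_form n n (\<lambda>x y. \<Sum>c\<in>?G. A c * cell_monomial (move t rs cs c) x y)"
    by (rule bilinear_form_sum_monomials) (auto intro: move_in_grid)
  moreover have "cell_monomial (move t rs cs c) x y = cell_monomial c
      (\<lambda>i. (if t then y else x) (rs ! i)) (\<lambda>j. (if t then x else y) (cs ! j))" for c x y
    by (simp add: cell_monomial_def move_def)
  ultimately show ?thesis
    by (simp add: A)
qed

context
  fixes F :: "cell set set"
  assumes F: "F \<subseteq> Pow (grid (length rs) (length cs))"
begin

lemma inj_on_image_move: "inj_on ((`) (move t rs cs)) F"
  using inj_on_image_Pow [OF inj_on_move] F by (rule inj_on_subset)

lemma reducible_config_move:
  assumes "reducible_config (length rs) (length cs) {} F"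
  shows "reducible_config n n {} ((`) (move t rs cs) ` F)"
proof -
  let ?p = "\<lambda>g x y. g (\<lambda>i. (if t then y else x) (rs ! i)) (\<lambda>j. (if t then x else y) (cs ! j))"
  obtain gs where gs: "length gs < card F"
      "\<forall>g\<in>set gs. bilinear_form (length rs) (length cs) g"
      "\<And>x y. (\<Sum>e\<in>F. (edge_form e x y)\<^sup>2) = (\<Sum>g\<leftarrow>gs. (g x y)\<^sup>2)"
    using assms by (auto simp: reducible_config_iff_list R_config_def P_config_def)
  have "(\<Sum>e\<in>(`) (move t rs cs) ` F. (edge_form e x y)\<^sup>2) = (\<Sum>g\<leftarrow>map ?p gs. (g x y)\<^sup>2)" for x y
  proof -
    have "(\<Sum>e\<in>(`) (move t rs cs) ` F. (edge_form e x y)\<^sup>2)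
        = (\<Sum>e\<in>F. (?p (edge_form e) x y)\<^sup>2)"
      unfolding sum.reindex [OF inj_on_image_move] o_def
      by (rule sum.cong [OF refl], subst edge_form_move) (use F in auto)
    then show ?thesis
      by (simp add: gs(3) o_def)
  qed
  then show ?thesis
    unfolding reducible_config_iff_list P_config_def R_config_def
    using gs(1,2) inj_on_image_move
    by (intro exI [of _ "map ?p gs"]) (auto simp: card_image intro: bilinear_form_move)
qed

lemma product_relation_move:
  assumes "product_relation {} F"
  shows "product_relation {} ((`) (move t rs cs) ` F)"
proof -
  obtain es c where es: "distinct es" "set es = F"
      and nz: "\<exists>b < length es. \<exists>a < b. c a b \<noteq> 0"
      and rel: "\<And>x y. (\<Sum>b < length es. \<Sum>a < b.
          c a b * edge_form (es ! a) x y * edge_form (es ! b) x y) = 0"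
    using assms by (auto simp: product_relation_def)
  have "es ! a \<subseteq> grid (length rs) (length cs)" if "a < length es" for a
    using that F es(2) nth_mem by fastforce
  then have "(\<Sum>b < length es. \<Sum>a < b. c a b * edge_form (map ((`) (move t rs cs)) es ! a) x y
      * edge_form (map ((`) (move t rs cs)) es ! b) x y) = 0" for x y
    by (subst rel [symmetric]) (auto intro!: sum.cong simp: edge_form_move)
  then show ?thesis
    unfolding product_relation_def using es nz inj_on_image_move
    by (intro exI [of _ "map ((`) (move t rs cs)) es"] exI [of _ c]) (simp add: distinct_map)
qed

lemma strip_overload_move:
  assumes "strip_overload (length rs) (length cs) {} F"
  shows "strip_overload n n {} ((`) (move t rs cs) ` F)"
proof -
  obtain q R C where RC: "R \<subseteq> {..<length rs}" "C \<subseteq> {..<length cs}"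
      "card R = 2 \<and> card C = q \<or> card R = q \<and> card C = 2"
      "card {e \<in> F. e \<subseteq> R \<times> C} > q + 1"
    using assms unfolding strip_overload_def by auto
  let ?R = "(!) rs ` R" and ?C = "(!) cs ` C"
  \<comment> \<open>A transposition turns the chosen rows into columns; the two alternatives in
    \<open>strip_overload\<close> allow for this.\<close>
  let ?U = "if t then ?C else ?R" and ?V = "if t then ?R else ?C"
  have inj: "inj_on ((!) rs) R" "inj_on ((!) cs) C"
    using RC(1,2) distinct by (auto simp: inj_on_def nth_eq_iff_index_eq subset_iff)
  have sub': "?R \<subseteq> {..<n}" "?C \<subseteq> {..<n}"
    using RC(1,2) sub by (auto simp: subset_iff)
  have fin: "finite ((`) (move t rs cs) ` F)"
    using finite_subset [OF F] by simp
  have "move t rs cs ` e \<subseteq> ?U \<times> ?V" if "e \<subseteq> R \<times> C" for e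
    using that by (fastforce simp: move_def)
  then have "(`) (move t rs cs) ` {e \<in> F. e \<subseteq> R \<times> C}
      \<subseteq> {e \<in> (`) (move t rs cs) ` F. e \<subseteq> ?U \<times> ?V}"
    by blast
  then have "card ((`) (move t rs cs) ` {e \<in> F. e \<subseteq> R \<times> C})
      \<le> card {e \<in> (`) (move t rs cs) ` F. e \<subseteq> ?U \<times> ?V}"
    using fin by (intro card_mono) simp_all
  moreover have "card ((`) (move t rs cs) ` {e \<in> F. e \<subseteq> R \<times> C}) = card {e \<in> F. e \<subseteq> R \<times> C}"
    by (rule card_image) (rule inj_on_subset [OF inj_on_image_move], auto)
  moreover have "card ?R = card R" "card ?C = card C"
    using inj by (auto simp: card_image)
  ultimately show ?thesis
    unfolding strip_overload_def using RC(3,4) sub'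
    by (intro exI [of _ q] exI [of _ ?U] exI [of _ ?V]) auto
qed

end

end

section \<open>The patterns\<close>

type_synonym pattern = "cell list list"
abbreviation edges :: "pattern \<Rightarrow> cell set set" where
  "edges p \<equiv> set ` set p"
definition relation5 :: pattern where
  "relation5 = [[(0,0),(0,1)], [(0,2)], [(1,0)], [(1,1)], [(1,2)]]"

definition relation6 :: pattern where
  "relation6 = [[(0,0),(1,1)], [(0,2)], [(1,2)], [(2,0)], [(2,1)], [(2,2)]]"

definition relation7 :: pattern where
  "relation7 = [[(0,0),(1,1)], [(0,2),(2,1)], [(0,3)], [(1,2)], [(1,3)], [(2,0)], [(2,3)]]"

definition relation7' :: pattern where
  "relation7' = [[(0,0),(0,1)], [(1,0),(2,2)], [(0,2)], [(0,3)], [(1,1)], [(1,3)], [(2,3)]]"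

definition relation8 :: pattern where
  "relation8 = [[(0,0),(1,1)], [(0,2),(2,3)], [(1,2)], [(2,0)], [(3,0)], [(3,1)], [(3,2)], [(3,3)]]"

definition relation9 :: pattern where
  "relation9 = [[(0,0),(1,1)], [(0,1),(1,2)], [(2,0),(3,1)], [(0,3)], [(1,3)], [(2,1)], [(2,3)],
     [(3,2)], [(3,3)]]"

definition chain1 :: pattern where
  "chain1 = [[(0,0),(1,1)], [(0,1)], [(0,2)], [(1,0)], [(1,2)]]"

definition chain2 :: pattern where
  "chain2 = [[(0,0),(1,1)], [(0,1),(1,2)], [(0,2)], [(0,3)], [(1,0)], [(1,3)]]"

definition pattern_S :: pattern where
  "pattern_S = [[(0,1),(2,0)], [(1,0),(2,2)], [(0,2)], [(1,1)], [(1,2)]]"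


section \<open>Relations and shorter sums of squares for the single patterns\<close>

lemma reducible_config_edges:
  assumes "distinct (map set p)" and "length gs < length p"
    and "\<And>g. g \<in> set gs \<Longrightarrow> bilinear_form m n g"
    and "\<And>x y. (\<Sum>e\<leftarrow>p. (edge_form (set e) x y)\<^sup>2) = (\<Sum>g\<leftarrow>gs. (g x y)\<^sup>2)"
  shows "reducible_config m n {} (edges p)"
proof -
  have "card (edges p) = length p"
    using distinct_card [OF assms(1)] by simp
  moreover have "P_config {} (edges p) x y = (\<Sum>g\<leftarrow>gs. (g x y)\<^sup>2)" for x y
    using sum.distinct_set_conv_list [OF assms(1), of "\<lambda>e. (edge_form e x y)\<^sup>2"]
    by (simp add: P_config_def o_def assms(4))
  ultimately show ?thesis
    unfolding reducible_config_iff_list R_config_def using assms(2,3) by auto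
qed

lemma product_relation_edges:
  assumes "\<And>x y. (\<Sum>b<length p. \<Sum>a<b.
      c a b * edge_form (set (p ! a)) x y * edge_form (set (p ! b)) x y) = 0"
    and "distinct (map set p)" and "\<exists>b<length p. \<exists>a<b. c a b \<noteq> 0"
  shows "product_relation {} (edges p)"
  unfolding product_relation_def using assms
  by (intro exI [of _ "map set p"] exI [of _ c]) (simp cong: sum.cong_simp)

text \<open>Here and below, uij is the monomial of cell (i,j). Both sides of u02(u10 + u11) =
  u12(u00 + u01) equal x0 x1 y2 (y0 + y1).\<close>

lemma product_relation_relation5: "product_relation {} (edges relation5)"
proof (rule product_relation_edges)
  show "(\<Sum>b<length relation5. \<Sum>a<b.
      (if (a, b) \<in> {(1,3), (1,2)} then 1 else if (a, b) \<in> {(0,4)} then -1 else 0)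
        * edge_form (set (relation5 ! a)) x y * edge_form (set (relation5 ! b)) x y) = 0" for x y
    by (simp add: relation5_def edge_form_def cell_monomial_def lessThan_Suc algebra_simps)
qed (auto simp: relation5_def doubleton_eq_iff)

lemma reducible_relation5: "reducible_config 2 3 {} (edges relation5)"
proof -
  \<comment> \<open>The factor u02 lies in two products, hence the weight 1/sqrt 2: g^2 + h^2 + k^2
    + 2r g(h + k) = (g + r(h + k))^2 + (r(h - k))^2 saves a square, and f^2 + h^2 - 2r f h = (f - r
    h)^2 + (r h)^2 keeps two for the other product.\<close>
  define r :: real where "r = sqrt (1 / 2)"
  have r: "r * r = 1 / 2" "r * (r * z) = z / 2" for z
    by (simp_all add: r_def flip: mult.assoc)
  define gs :: "xy_poly list" where "gs =
    [\<lambda>x y. (x 0 * y 2) + r * ((x 1 * y 1) + (x 1 * y 0)),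
     \<lambda>x y. r * ((x 1 * y 1) - (x 1 * y 0)),
     \<lambda>x y. (x 0 * y 0 + x 0 * y 1) - r * (x 1 * y 2),
     \<lambda>x y. r * (x 1 * y 2)]"
  show ?thesis
  proof (rule reducible_config_edges)
    show "length gs < length relation5" "distinct (map set relation5)"
      by (auto simp: gs_def relation5_def doubleton_eq_iff)
    show "bilinear_form 2 3 g" if "g \<in> set gs" for g
      using that by (auto simp: gs_def intro!: bilinear_form_intros)
    show "(\<Sum>e\<leftarrow>relation5. (edge_form (set e) x y)\<^sup>2) = (\<Sum>g\<leftarrow>gs. (g x y)\<^sup>2)" for x y
      by (simp add: gs_def relation5_def edge_form_def cell_monomial_def power2_eq_square
          algebra_simps r)
  qed
qed

text \<open>In u22(u00 + u11) = u02 u20 + u12 u21 no factor is shared, so weight 1 merges the two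
  squares of each product into one.\<close>

lemma reducible_relation6: "reducible_config 3 3 {} (edges relation6)"
proof -
  define r :: real where "r = sqrt (1 / 2)"
  have r: "r * r = 1 / 2" "r * (r * z) = z / 2" for z
    by (simp_all add: r_def flip: mult.assoc)
  define gs :: "xy_poly list" where "gs =
    [\<lambda>x y. (x 1 * y 2) + (x 2 * y 1),
     \<lambda>x y. (x 0 * y 2) + (x 2 * y 0),
     \<lambda>x y. (x 0 * y 0 + x 1 * y 1) - (x 2 * y 2)]"
  show ?thesis
  proof (rule reducible_config_edges)
    show "length gs < length relation6" "distinct (map set relation6)"
      by (auto simp: gs_def relation6_def doubleton_eq_iff)
    show "bilinear_form 3 3 g" if "g \<in> set gs" for g
      using that by (auto simp: gs_def intro!: bilinear_form_intros)
    show "(\<Sum>e\<leftarrow>relation6. (edge_form (set e) x y)\<^sup>2) = (\<Sum>g\<leftarrow>gs. (g x y)\<^sup>2)" for x y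
      by (simp add: gs_def relation6_def edge_form_def cell_monomial_def power2_eq_square
          algebra_simps r)
  qed
qed

text \<open>The relation is u03 u20 + u13(u02 + u21) = u23(u00 + u11) + u03 u12, with u03
  shared.\<close>

lemma product_relation_relation7: "product_relation {} (edges relation7)"
proof (rule product_relation_edges)
  show "(\<Sum>b<length relation7. \<Sum>a<b.
      (if (a, b) \<in> {(2,5), (1,4)} then 1 else if (a, b) \<in> {(0,6), (2,3)} then -1 else 0)
        * edge_form (set (relation7 ! a)) x y * edge_form (set (relation7 ! b)) x y) = 0" for x y
    by (simp add: relation7_def edge_form_def cell_monomial_def lessThan_Suc algebra_simps)
qed (auto simp: relation7_def doubleton_eq_iff)

lemma reducible_relation7: "reducible_config 3 4 {} (edges relation7)"
proof -
  define r :: real where "r = sqrt (1 / 2)"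
  have r: "r * r = 1 / 2" "r * (r * z) = z / 2" for z
    by (simp_all add: r_def flip: mult.assoc)
  define gs :: "xy_poly list" where "gs =
    [\<lambda>x y. (x 0 * y 3) + r * ((x 2 * y 0) - (x 1 * y 2)),
     \<lambda>x y. r * ((x 2 * y 0) + (x 1 * y 2)),
     \<lambda>x y. (x 0 * y 0 + x 1 * y 1) - r * (x 2 * y 3),
     \<lambda>x y. r * (x 2 * y 3),
     \<lambda>x y. (x 0 * y 2 + x 2 * y 1) + r * (x 1 * y 3),
     \<lambda>x y. r * (x 1 * y 3)]"
  show ?thesis
  proof (rule reducible_config_edges)
    show "length gs < length relation7" "distinct (map set relation7)"
      by (auto simp: gs_def relation7_def doubleton_eq_iff)
    show "bilinear_form 3 4 g" if "g \<in> set gs" for g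
      using that by (auto simp: gs_def intro!: bilinear_form_intros)
    show "(\<Sum>e\<leftarrow>relation7. (edge_form (set e) x y)\<^sup>2) = (\<Sum>g\<leftarrow>gs. (g x y)\<^sup>2)" for x y
      by (simp add: gs_def relation7_def edge_form_def cell_monomial_def power2_eq_square
          algebra_simps r)
  qed
qed

text \<open>The relation is u03(u11 + (u10 + u22)) = u13(u00 + u01) + u02 u23; the shared factor u03
  again calls for weight 1/sqrt 2.\<close>

lemma reducible_relation7': "reducible_config 3 4 {} (edges relation7')"
proof -
  define r :: real where "r = sqrt (1 / 2)"
  have r: "r * r = 1 / 2" "r * (r * z) = z / 2" for z
    by (simp_all add: r_def flip: mult.assoc)
  define gs :: "xy_poly list" where "gs =
    [\<lambda>x y. (x 0 * y 3) + r * ((x 1 * y 1) + (x 1 * y 0 + x 2 * y 2)),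
     \<lambda>x y. r * ((x 1 * y 1) - (x 1 * y 0 + x 2 * y 2)),
     \<lambda>x y. (x 0 * y 0 + x 0 * y 1) - r * (x 1 * y 3),
     \<lambda>x y. r * (x 1 * y 3),
     \<lambda>x y. (x 0 * y 2) - r * (x 2 * y 3),
     \<lambda>x y. r * (x 2 * y 3)]"
  show ?thesis
  proof (rule reducible_config_edges)
    show "length gs < length relation7'" "distinct (map set relation7')"
      by (auto simp: gs_def relation7'_def doubleton_eq_iff)
    show "bilinear_form 3 4 g" if "g \<in> set gs" for g
      using that by (auto simp: gs_def intro!: bilinear_form_intros)
    show "(\<Sum>e\<leftarrow>relation7'. (edge_form (set e) x y)\<^sup>2) = (\<Sum>g\<leftarrow>gs. (g x y)\<^sup>2)" for x y
      by (simp add: gs_def relation7'_def edge_form_def cell_monomial_def power2_eq_square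
          algebra_simps r)
  qed
qed

text \<open>The relation is u20 u33 + u32(u00 + u11) = u12 u31 + u30(u02 + u23). No factor is
  shared, so weight 1 will halve the number of squares.\<close>

lemma product_relation_relation8: "product_relation {} (edges relation8)"
proof (rule product_relation_edges)
  show "(\<Sum>b<length relation8. \<Sum>a<b.
      (if (a, b) \<in> {(3,7), (0,6)} then 1 else if (a, b) \<in> {(2,5), (1,4)} then -1 else 0)
        * edge_form (set (relation8 ! a)) x y * edge_form (set (relation8 ! b)) x y) = 0" for x y
    by (simp add: relation8_def edge_form_def cell_monomial_def lessThan_Suc algebra_simps)
qed (auto simp: relation8_def doubleton_eq_iff)

lemma reducible_relation8: "reducible_config 4 4 {} (edges relation8)"
proof -
  define r :: real where "r = sqrt (1 / 2)"
  have r: "r * r = 1 / 2" "r * (r * z) = z / 2" for z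
    by (simp_all add: r_def flip: mult.assoc)
  define gs :: "xy_poly list" where "gs =
    [\<lambda>x y. (x 2 * y 0) + (x 3 * y 3),
     \<lambda>x y. (x 1 * y 2) - (x 3 * y 1),
     \<lambda>x y. (x 0 * y 2 + x 2 * y 3) - (x 3 * y 0),
     \<lambda>x y. (x 0 * y 0 + x 1 * y 1) + (x 3 * y 2)]"
  show ?thesis
  proof (rule reducible_config_edges)
    show "length gs < length relation8" "distinct (map set relation8)"
      by (auto simp: gs_def relation8_def doubleton_eq_iff)
    show "bilinear_form 4 4 g" if "g \<in> set gs" for g
      using that by (auto simp: gs_def intro!: bilinear_form_intros)
    show "(\<Sum>e\<leftarrow>relation8. (edge_form (set e) x y)\<^sup>2) = (\<Sum>g\<leftarrow>gs. (g x y)\<^sup>2)" for x y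
      by (simp add: gs_def relation8_def edge_form_def cell_monomial_def power2_eq_square
          algebra_simps r)
  qed
qed

text \<open>The relation is u13(u32 + u21) + u03(u20 + u31) = u23(u00 + u11) + u33(u01 + u12), with
  u13 shared.\<close>

lemma product_relation_relation9: "product_relation {} (edges relation9)"
proof (rule product_relation_edges)
  show "(\<Sum>b<length relation9. \<Sum>a<b.
      (if (a, b) \<in> {(4,7), (4,5), (2,3)} then 1 else if (a, b) \<in> {(0,6), (1,8)} then -1 else 0)
        * edge_form (set (relation9 ! a)) x y * edge_form (set (relation9 ! b)) x y) = 0" for x y
    by (simp add: relation9_def edge_form_def cell_monomial_def lessThan_Suc algebra_simps)
qed (auto simp: relation9_def doubleton_eq_iff)

lemma reducible_relation9: "reducible_config 4 4 {} (edges relation9)"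
proof -
  define r :: real where "r = sqrt (1 / 2)"
  have r: "r * r = 1 / 2" "r * (r * z) = z / 2" for z
    by (simp_all add: r_def flip: mult.assoc)
  define gs :: "xy_poly list" where "gs =
    [\<lambda>x y. (x 1 * y 3) + r * ((x 3 * y 2) + (x 2 * y 1)),
     \<lambda>x y. r * ((x 3 * y 2) - (x 2 * y 1)),
     \<lambda>x y. (x 2 * y 0 + x 3 * y 1) + r * (x 0 * y 3),
     \<lambda>x y. r * (x 0 * y 3),
     \<lambda>x y. (x 0 * y 0 + x 1 * y 1) - r * (x 2 * y 3),
     \<lambda>x y. r * (x 2 * y 3),
     \<lambda>x y. (x 0 * y 1 + x 1 * y 2) - r * (x 3 * y 3),
     \<lambda>x y. r * (x 3 * y 3)]"
  show ?thesis
  proof (rule reducible_config_edges)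
    show "length gs < length relation9" "distinct (map set relation9)"
      by (auto simp: gs_def relation9_def doubleton_eq_iff)
    show "bilinear_form 4 4 g" if "g \<in> set gs" for g
      using that by (auto simp: gs_def intro!: bilinear_form_intros)
    show "(\<Sum>e\<leftarrow>relation9. (edge_form (set e) x y)\<^sup>2) = (\<Sum>g\<leftarrow>gs. (g x y)\<^sup>2)" for x y
      by (simp add: gs_def relation9_def edge_form_def cell_monomial_def power2_eq_square
          algebra_simps r)
  qed
qed

text \<open>
  The squares come from a Gram matrix with blocks \<open>I, M, M\<^sup>T, I\<close>, where \<open>M\<close> pairs the first row
  with the second one.  Modulo the relations between the monomials, \<open>M\<close> may be changed by any
  skew-symmetric matrix; it is chosen such that two of its three singular values are 1.
\<close>

lemma reducible_chain1: "reducible_config 2 3 {} (edges chain1)"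
proof -
  \<comment> \<open>The cross term 2 u00 u11 = u00 u11 + u01 u10 is split over the first two forms,
    whence the coefficients 1/2; \<open>s\<close> makes (1/2, s) and (s, -1/2) orthonormal.\<close>
  define s :: real where "s = sqrt (3 / 4)"
  have s: "s * s = 3 / 4" "s * (s * z) = 3 / 4 * z" for z
    by (simp_all add: s_def flip: mult.assoc)
  define gs :: "xy_poly list" where "gs =
    [\<lambda>x y. x 0 * y 1 + 1/2 * (x 1 * y 0) + s * (x 1 * y 2),
     \<lambda>x y. x 1 * y 1 + 1/2 * (x 0 * y 0) - s * (x 0 * y 2),
     \<lambda>x y. s * (x 1 * y 0) - 1/2 * (x 1 * y 2),
     \<lambda>x y. s * (x 0 * y 0) + 1/2 * (x 0 * y 2)]"
  show ?thesis
  proof (rule reducible_config_edges)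
    show "length gs < length chain1" "distinct (map set chain1)"
      by (auto simp: gs_def chain1_def doubleton_eq_iff)
    show "bilinear_form 2 3 g" if "g \<in> set gs" for g
      using that by (auto simp: gs_def intro!: bilinear_form_intros)
    show "(\<Sum>e\<leftarrow>chain1. (edge_form (set e) x y)\<^sup>2) = (\<Sum>g\<leftarrow>gs. (g x y)\<^sup>2)" for x y
      by (simp add: gs_def chain1_def edge_form_def cell_monomial_def power2_eq_square
          algebra_simps s)
  qed
qed

text \<open>
  With \<open>p = (y 0 - y 2) / \<surd>2\<close> and \<open>q = (y 0 + y 2) / \<surd>2\<close> the sum of squares separates into a part in
  \<open>p, y 3\<close>, which needs two squares, and a part in \<open>q, y 1\<close>, which needs three.
\<close>

lemma reducible_chain2: "reducible_config 2 4 {} (edges chain2)"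
proof -
  define r where "r = sqrt (2::real)"
  \<comment> \<open>The cross term 2r q x0 x1 y1 forces the coefficient r - 1 in the fourth form,
    and (r - 1)^2 + s^2 = 1 restores the square of u01.\<close>
  define s where "s = sqrt (2 * r - 2)"
  have "1 \<le> r"
    by (simp add: r_def)
  then have s: "s * s = 2 * r - 2" "s * (s * z) = 2 * (r * z) - 2 * z" for z
    by (simp_all add: s_def algebra_simps flip: mult.assoc)
  have r: "r * r = 2" "r * (r * z) = 2 * z" for z
    by (simp_all add: r_def flip: mult.assoc)
  define gs :: "xy_poly list" where "gs =
    [\<lambda>x y. r/2 * (x 0 * y 0 - x 0 * y 2) + x 1 * y 3,
     \<lambda>x y. r/2 * (x 1 * y 0 - x 1 * y 2) - x 0 * y 3,
     \<lambda>x y. r/2 * (x 0 * y 0 + x 0 * y 2) + x 1 * y 1,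
     \<lambda>x y. r/2 * (x 1 * y 0 + x 1 * y 2) + (r - 1) * (x 0 * y 1),
     \<lambda>x y. s * (x 0 * y 1)]"
  show ?thesis
  proof (rule reducible_config_edges)
    show "length gs < length chain2" "distinct (map set chain2)"
      by (auto simp: gs_def chain2_def doubleton_eq_iff)
    show "bilinear_form 2 4 g" if "g \<in> set gs" for g
      using that by (auto simp: gs_def intro!: bilinear_form_intros)
    show "(\<Sum>e\<leftarrow>chain2. (edge_form (set e) x y)\<^sup>2) = (\<Sum>g\<leftarrow>gs. (g x y)\<^sup>2)" for x y
      by (simp add: gs_def chain2_def edge_form_def cell_monomial_def power2_eq_square
          algebra_simps r s)
  qed
qed

text \<open>The forms are the right-hand side of (S) with x, y, z and a, b, d both taken as 0, 1,
  2.\<close>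

lemma reducible_pattern_S: "reducible_config 3 3 {} (edges pattern_S)"
proof (rule reducible_config_edges)
  let ?gs = "[\<lambda>x y. x 0 * y 1 + x 1 * y 2 + x 2 * y 0, \<lambda>x y. x 0 * y 2 - x 1 * y 1,
    \<lambda>x y. x 1 * y 0, \<lambda>x y. x 2 * y 2] :: xy_poly list"
  show "length ?gs < length pattern_S" "distinct (map set pattern_S)"
    by (auto simp: pattern_S_def doubleton_eq_iff)
  show "bilinear_form 3 3 g" if "g \<in> set ?gs" for g
    using that by (auto intro!: bilinear_form_intros)
  show "(\<Sum>e\<leftarrow>pattern_S. (edge_form (set e) x y)\<^sup>2) = (\<Sum>g\<leftarrow>?gs. (g x y)\<^sup>2)" for x y
    by (simp add: pattern_S_def edge_form_def cell_monomial_def power2_eq_square algebra_simps)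
qed

lemma strip_overload_edges:
  assumes "distinct (map set p)" and "length p > n + 1" and "edges p \<subseteq> Pow (grid 2 n)"
  shows "strip_overload 2 n {} (edges p)"
proof -
  have "{e \<in> edges p. e \<subseteq> {..<2} \<times> {..<n}} = edges p"
    using assms(3) by (auto simp: grid_def)
  moreover have "card (edges p) = length p"
    using distinct_card [OF assms(1)] by simp
  ultimately show ?thesis
    unfolding strip_overload_def using assms(2)
    by (intro exI [of _ n] exI [of _ "{..<2}"] exI [of _ "{..<n}"]) simp
qed

lemma strip_overload_chain1: "strip_overload 2 3 {} (edges chain1)"
  by (rule strip_overload_edges) (auto simp: chain1_def doubleton_eq_iff grid_def)

lemma strip_overload_chain2: "strip_overload 2 4 {} (edges chain2)"
  by (rule strip_overload_edges) (auto simp: chain2_def doubleton_eq_iff grid_def)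

section \<open>Searching all matchings\<close>

text \<open>
  A list \<open>T\<close> of pairs stands for a set of two-edges.  When the edge \<open>{c, d}\<close> is chosen,
  \<open>select c d\<close> keeps the lists \<open>T\<close> that can still be contained in the matching and removes the
  chosen edge from them; a list that becomes empty has been hit.  \<open>prepend_if\<close> keeps conditionals
  out of the recursive equations, which speeds up their evaluation by rewriting.
\<close>

fun prepend_if :: "bool \<Rightarrow> 'a \<Rightarrow> 'a list \<Rightarrow> 'a list" where
  "prepend_if True x xs = x # xs"
| "prepend_if False x xs = xs"

fun compatible :: "'a \<Rightarrow> 'a \<Rightarrow> ('a \<times> 'a) list \<Rightarrow> bool" where
  "compatible c d [] \<longleftrightarrow> True"
| "compatible c d ((a, b) # T) \<longleftrightarrow>
     (if a = c then b = d else if a = d then b = c else b \<noteq> c \<and> b \<noteq> d) \<and> compatible c d T"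

fun remainder :: "'a \<Rightarrow> 'a \<Rightarrow> ('a \<times> 'a) list \<Rightarrow> ('a \<times> 'a) list" where
  "remainder c d [] = []"
| "remainder c d ((a, b) # T) = prepend_if (a \<noteq> c \<and> a \<noteq> d) (a, b) (remainder c d T)"

fun select :: "'a \<Rightarrow> 'a \<Rightarrow> ('a \<times> 'a) list list \<Rightarrow> ('a \<times> 'a) list list" where
  "select c d [] = []"
| "select c d (T # B) = prepend_if (compatible c d T) (remainder c d T) (select c d B)"

lemma prepend_if_eq: "prepend_if b x xs = (if b then x # xs else xs)"
  by simp

lemma compatible_iff: "compatible c d T \<longleftrightarrow> (\<forall>(a, b)\<in>set T.
    if a = c then b = d else if a = d then b = c else b \<noteq> c \<and> b \<noteq> d)"
  by (induction c d T rule: compatible.induct) auto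

lemma set_remainder: "set (remainder c d T) = {(a, b). (a, b) \<in> set T \<and> a \<noteq> c \<and> a \<noteq> d}"
  by (induction c d T rule: remainder.induct) (auto simp: prepend_if_eq)

lemma set_select: "set (select c d B) = remainder c d ` {T \<in> set B. compatible c d T}"
  by (induction c d B rule: select.induct) (auto simp: prepend_if_eq)

text \<open>
  A state \<open>(k, cs, B)\<close> consists of the cells \<open>cs\<close> still to be matched, of which at most \<open>k\<close> may stay
  uncovered, and the lists \<open>B\<close> still to be hit; \<open>n\<close> bounds the depth of the search.
\<close>

fun branches :: "nat \<Rightarrow> 'a \<Rightarrow> 'a list \<Rightarrow> 'a list \<Rightarrow> ('a \<times> 'a) list list \<Rightarrow>
    (nat \<times> 'a list \<times> ('a \<times> 'a) list list) list" where
  "branches k c [] cs B = []"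
| "branches k c (d # ds) cs B = (k, removeAll d cs, select c d B) # branches k c ds cs B"

fun children :: "nat \<Rightarrow> 'a list \<Rightarrow> ('a \<times> 'a) list list \<Rightarrow>
    (nat \<times> 'a list \<times> ('a \<times> 'a) list list) list" where
  "children k [] B = []"
| "children 0 (c # cs) B = branches 0 c cs cs B"
| "children (Suc k) (c # cs) B = (k, cs, B) # branches (Suc k) c cs cs B"

fun hits_all :: "nat \<Rightarrow> nat \<times> 'a list \<times> ('a \<times> 'a) list list \<Rightarrow> bool" where
  "hits_all 0 (k, cs, B) \<longleftrightarrow> list_ex (\<lambda>T. T = []) B"
| "hits_all (Suc n) (k, cs, B) \<longleftrightarrow> (if list_ex (\<lambda>T. T = []) B then True
     else if cs = [] then False else list_all (hits_all n) (children k cs B))"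

lemma set_branches:
  "set (branches k c ds cs B) = (\<lambda>d. (k, removeAll d cs, select c d B)) ` set ds"
  by (induction k c ds cs B rule: branches.induct) auto

text \<open>Induction on the depth. The first cell \<open>c\<close> is either matched to some
  \<open>d\<close>, which leads to the child for \<open>d\<close>, or uncovered, which uses up one
  of the \<open>k\<close> exceptions. The bound on \<open>length cs\<close> is the invariant that
  \<open>K\<close> leaves at most \<open>k\<close> cells uncovered.\<close>

lemma hits_all_sound:
  fixes cs :: "'a list"
  assumes "hits_all n (k, cs, B)" and "distinct cs" and "\<And>e. e \<in> K \<Longrightarrow> e \<subseteq> set cs \<and> card e = 2"
    and "disjoint K" and "length cs \<le> 2 * card K + k"
  shows "\<exists>T\<in>set B. \<forall>(a, b)\<in>set T. {a, b} \<in> K"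
proof (cases "[] \<in> set B")
  case True
  then show ?thesis
    by force
next
  case False
  with assms show ?thesis
  proof (induction n arbitrary: k cs B K)
    case 0
    then show ?case
      by (simp add: list_ex_iff)
  next
    case (Suc n)
    note cs = Suc.prems(2) and K = Suc.prems(3) and disj = Suc.prems(4) and len = Suc.prems(5)
    \<comment> \<open>A child may contain the empty list, so the induction hypothesis is restated
      without excluding it.\<close>
    have IH: "\<exists>T\<in>set B. \<forall>(a, b)\<in>set T. {a, b} \<in> K"
      if "hits_all n (k, cs, B)" "distinct cs" "\<And>e. e \<in> K \<Longrightarrow> e \<subseteq> set cs \<and> card e = 2"
        "disjoint K" "length cs \<le> 2 * card K + k" for k B K and cs :: "'a list"
    proof (cases "[] \<in> set B")
      case True
      then show ?thesis
        by force
    next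
      case False
      show ?thesis
        by (rule Suc.IH [OF that(1,2) _ that(4,5) False]) (rule that(3))
    qed
    from Suc.prems(1,6) have ch: "cs \<noteq> []" "\<And>x. x \<in> set (children k cs B) \<Longrightarrow> hits_all n x"
      by (auto simp: list_ex_iff list_all_iff split: if_splits)
    then obtain c ds where cs_eq: "cs = c # ds"
      by (cases cs) auto
    have step: "hits_all n (k, removeAll d ds, select c d B)" if "d \<in> set ds" for d
      using that by (intro ch(2)) (cases k; simp add: cs_eq set_branches)
    have finK: "finite K"
      using K by (intro finite_subset [of K "Pow (set cs)"]) auto
    have c: "c \<notin> set ds" "distinct ds"
      using cs by (auto simp: cs_eq)
    show ?case
    proof (cases "\<exists>e\<in>K. c \<in> e")
      case True
      then obtain e where e: "e \<in> K" "c \<in> e" by blast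
      then obtain d where d: "e = {c, d}" "c \<noteq> d"
        using K [OF e(1)] by (auto simp: card_2_iff)
      then have d_in: "d \<in> set ds"
        using K [OF e(1)] by (auto simp: cs_eq)
      have disj_e: "e' \<inter> {c, d} = {}" if "e' \<in> K - {e}" for e'
        using disj e(1) that d(1) by (auto simp: disjoint_def)
      have "length (removeAll d ds) = length ds - 1"
        using c(2) d_in by (simp add: distinct_remove1_removeAll [symmetric] length_remove1)
      moreover have "card (K - {e}) = card K - 1" "card K > 0"
        using e(1) finK by (auto simp: card_gt_0_iff)
      \<comment> \<open>Two cells and one edge are gone, so the bound persists with the same
        \<open>k\<close>.\<close>
      ultimately have "length (removeAll d ds) \<le> 2 * card (K - {e}) + k"
        using len by (auto simp: cs_eq)
      moreover have "e' \<subseteq> set (removeAll d ds) \<and> card e' = 2" if "e' \<in> K - {e}" for e'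
        using K [of e'] disj_e [OF that] that by (auto simp: cs_eq)
      moreover have "disjoint (K - {e})"
        using disj by (auto simp: disjoint_def)
      ultimately have "\<exists>T\<in>set (select c d B). \<forall>(a, b)\<in>set T. {a, b} \<in> K - {e}"
        using IH [OF step [OF d_in], of "K - {e}"] distinct_removeAll [OF c(2)] by blast
      \<comment> \<open>Each pair of a compatible list is \<open>{c, d}\<close> itself, or disjoint
        from it and kept in the remainder.\<close>
      then obtain T where T: "T \<in> set B"
          "\<And>a b. (a, b) \<in> set T \<Longrightarrow>
             if a = c then b = d else if a = d then b = c else b \<noteq> c \<and> b \<noteq> d"
          "\<And>a b. (a, b) \<in> set T \<Longrightarrow> a \<noteq> c \<Longrightarrow> a \<noteq> d \<Longrightarrow> {a, b} \<in> K"
        by (fastforce simp: set_select compatible_iff set_remainder)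
      have "{a, b} \<in> K" if "(a, b) \<in> set T" for a b
        using T(2,3) [OF that] e(1) d(1) by (auto split: if_splits simp: insert_commute)
      with T(1) show ?thesis by blast
    next
      case False
      then have K': "e \<subseteq> set ds \<and> card e = 2" if "e \<in> K" for e
        using K [OF that] that by (auto simp: cs_eq)
      \<comment> \<open>The disjoint pairs all lie in \<open>ds\<close>, so
        \<open>2 * card K < length cs\<close>; hence \<open>k\<close> is positive and the child
        skipping \<open>c\<close> exists.\<close>
      have "card (\<Union>K) = (\<Sum>e\<in>K. card e)"
        using K' disj by (intro card_Union_disjoint)
          (auto simp: disjoint_def pairwise_def disjnt_def intro: finite_subset)
      then have "2 * card K = card (\<Union>K)"
        using K' by simp
      also have "\<dots> \<le> length ds"
        using card_mono [of "set ds" "\<Union>K"] K' distinct_card [OF c(2)] by auto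
      finally obtain k' where k: "k = Suc k'"
        using len by (cases k) (auto simp: cs_eq)
      have "hits_all n (k', ds, B)"
        by (rule ch(2)) (simp add: cs_eq k)
      then show ?thesis
        using IH [of k' ds B K] K' disj c(2) len by (simp add: k cs_eq)
    qed
  qed
qed

section \<open>The configurations with one-edges \<open>A5\<close> and \<open>B5\<close>\<close>

text \<open>The inner map puts a pattern in a representative position of the grid, the outer one
  applies a symmetry.\<close>

definition placements :: "(pattern \<times> nat list \<times> nat list) list \<Rightarrow>
    (bool \<times> nat list \<times> nat list) list \<Rightarrow> pattern list" where
  "placements ps hs =
     [map (map (move t rs' cs')) (map (map (move False rs cs)) p).
       (p, rs, cs) \<leftarrow> ps, (t, rs', cs') \<leftarrow> hs]"

definition two_edges :: "pattern \<Rightarrow> (cell \<times> cell) list" where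
  "two_edges p = [(e ! 0, e ! 1). e \<leftarrow> p, length e \<noteq> 1]"

definition one_edges_in :: "cell set \<Rightarrow> pattern \<Rightarrow> bool" where
  "one_edges_in E p = list_all (\<lambda>e. length e = 2 \<or> length e = 1 \<and> e ! 0 \<in> E) p"

definition injection :: "nat \<Rightarrow> nat list \<Rightarrow> bool" where
  "injection n rs \<longleftrightarrow> distinct rs \<and> list_all (\<lambda>i. i < n) rs"

definition free_cells :: "cell set \<Rightarrow> cell list" where
  "free_cells E = [c \<leftarrow> List.product [0..<5] [0..<5]. c \<notin> E]"

lemma set_free_cells: "set (free_cells E) = grid 5 5 - E"
  by (auto simp: free_cells_def grid_def)

lemma distinct_free_cells: "distinct (free_cells E)"
  by (simp add: free_cells_def distinct_product)

lemma edges_map: "edges (map (map f) p) = (`) f ` edges p"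
  by (simp add: image_image)

text \<open>The search only controls the two-edges of a pattern; the one-edges are checked
  beforehand against \<open>E\<close>.\<close>

lemma edges_subset_selected:
  assumes "one_edges_in E p" and "\<forall>(a, b)\<in>set (two_edges p). {a, b} \<in> K"
  shows "edges p \<subseteq> selected_edges E K"
proof
  fix e assume "e \<in> edges p"
  then obtain l where l: "l \<in> set p" "e = set l"
    by auto
  with assms(1) consider "length l = 2" | "length l = 1" "l ! 0 \<in> E"
    by (auto simp: one_edges_in_def list_all_iff)
  then show "e \<in> selected_edges E K"
  proof cases
    case 1
    then have "set l = {l ! 0, l ! 1}"
      by (auto simp: numeral_2_eq_2 length_Suc_conv)
    moreover have "(l ! 0, l ! 1) \<in> set (two_edges p)"
      using l(1) 1 by (force simp: two_edges_def)
    ultimately show ?thesis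
      using assms(2) l(2) by (auto simp: selected_edges_def)
  next
    case 2
    then show ?thesis
      using l(2) by (auto simp: selected_edges_def length_Suc_conv)
  qed
qed

locale placed_patterns =
  fixes ps :: "(pattern \<times> nat list \<times> nat list) list" and hs :: "(bool \<times> nat list \<times> nat list) list"
    and n :: nat
  assumes ps: "\<forall>(p, rs, cs)\<in>set ps. injection n rs \<and> injection n cs \<and>
      edges p \<subseteq> Pow (grid (length rs) (length cs))"
    and hs: "list_all (\<lambda>(t, rs, cs). injection n rs \<and> injection n cs \<and>
      length rs = n \<and> length cs = n) hs"
begin

lemma placementE:
  assumes "p' \<in> set (placements ps hs)"
  obtains p rs cs t rs' cs' where "(p, rs, cs) \<in> set ps"
    and "edges p' = (`) (move t rs' cs') ` (`) (move False rs cs) ` edges p"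
    and "distinct rs" "distinct cs" "set rs \<subseteq> {..<n}" "set cs \<subseteq> {..<n}"
    and "distinct rs'" "distinct cs'" "set rs' \<subseteq> {..<n}" "set cs' \<subseteq> {..<n}"
    and "edges p \<subseteq> Pow (grid (length rs) (length cs))"
    and "(`) (move False rs cs) ` edges p \<subseteq> Pow (grid (length rs') (length cs'))"
    and "length rs' = n" "length cs' = n"
proof -
  obtain p rs cs t rs' cs' where p: "(p, rs, cs) \<in> set ps" and h: "(t, rs', cs') \<in> set hs"
      and p': "p' = map (map (move t rs' cs')) (map (map (move False rs cs)) p)"
    using assms by (auto simp: placements_def)
  have rs: "distinct rs" "distinct cs" "set rs \<subseteq> {..<n}" "set cs \<subseteq> {..<n}"
    and F: "edges p \<subseteq> Pow (grid (length rs) (length cs))"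
    using bspec [OF ps p] by (auto simp: injection_def list_all_iff)
  have rs': "distinct rs'" "distinct cs'" "set rs' \<subseteq> {..<n}" "set cs' \<subseteq> {..<n}"
    and len: "length rs' = n" "length cs' = n"
    using hs h by (auto simp: injection_def list_all_iff)
  have "(`) (move False rs cs) ` edges p \<subseteq> Pow (grid (length rs') (length cs'))"
    unfolding len using F move_in_grid [OF rs] by blast
  with that [OF p _ rs rs' F _ len] show thesis
    unfolding p' edges_map by blast
qed

lemma reducible_placement:
  assumes "p' \<in> set (placements ps hs)"
    and "\<And>p rs cs. (p, rs, cs) \<in> set ps \<Longrightarrow> reducible_config (length rs) (length cs) {} (edges p)"
  shows "reducible_config n n {} (edges p')"
  using assms(1)
proof (cases rule: placementE)
  case (1 p rs cs t rs' cs')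
  have "reducible_config n n {} ((`) (move False rs cs) ` edges p)"
    by (rule reducible_config_move [OF 1(3-6,11) assms(2) [OF 1(1)]])
  then show ?thesis
    unfolding 1(2) using reducible_config_move [OF 1(7-10,12)] by (simp only: 1(13,14))
qed

lemma excluded_placement:
  assumes "p' \<in> set (placements ps hs)"
    and "\<And>p rs cs. (p, rs, cs) \<in> set ps \<Longrightarrow>
      strip_overload (length rs) (length cs) {} (edges p) \<or> product_relation {} (edges p)"
  shows "strip_overload n n {} (edges p') \<or> product_relation {} (edges p')"
  using assms(1)
proof (cases rule: placementE)
  case (1 p rs cs t rs' cs')
  have "strip_overload n n {} ((`) (move False rs cs) ` edges p) \<or>
      product_relation {} ((`) (move False rs cs) ` edges p)"
    using assms(2) [OF 1(1)] strip_overload_move [OF 1(3-6,11)]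
      product_relation_move [OF 1(3-6,11)] by iprover
  then show ?thesis
    unfolding 1(2) using strip_overload_move [OF 1(7-10,12)] product_relation_move [OF 1(7-10,12)]
    unfolding 1(13,14) by iprover
qed

end

lemma nat_numerals:
  "(2::nat) = Suc (Suc 0)" "(3::nat) = Suc (Suc (Suc 0))" "(4::nat) = Suc (Suc (Suc (Suc 0)))"
  by simp_all

definition patterns_B :: "(pattern \<times> nat list \<times> nat list) list" where
  "patterns_B =
    [(relation5, [0,1], [3,4,0]), (relation5, [2,0], [0,2,1]), (relation5, [3,0], [0,2,1]),
     (relation5, [3,1], [0,3,4]), (chain1, [0,1], [3,1,0]), (chain1, [0,1], [3,2,0]),
     (chain1, [0,1], [4,2,0]), (chain1, [0,2], [3,0,1]), (chain1, [0,2], [3,2,1]),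
     (chain1, [0,3], [4,0,1]), (chain1, [0,3], [4,2,1]), (relation6, [2,3,0], [0,2,1]),
     (relation6, [2,3,0], [2,0,1]), (relation7, [0,2,3], [4,0,3,1]),
     (relation7, [0,2,3], [4,2,3,1]), (relation7, [2,0,3], [4,3,2,1]),
     (relation7', [2,3,0], [2,4,3,1]), (relation7', [3,0,2], [3,2,4,1]),
     (relation7', [3,2,0], [2,3,4,1]), (chain2, [0,2], [3,4,0,1]), (chain2, [0,2], [3,4,2,1]),
     (chain2, [0,3], [4,3,0,1]), (chain2, [0,3], [4,3,2,1]), (chain2, [0,4], [3,4,0,2]),
     (chain2, [0,4], [3,4,1,2]), (chain2, [2,3], [4,0,3,1]), (pattern_S, [0,1,2], [2,4,0]),
     (pattern_S, [0,1,3], [2,3,0]), (pattern_S, [0,1,4], [1,4,0]), (pattern_S, [2,0,4], [4,2,1])]"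

definition patterns_A :: "(pattern \<times> nat list \<times> nat list) list" where
  "patterns_A =
    [(relation5, [1,0], [2,3,1]), (chain1, [0,1], [0,2,1]), (chain1, [1,2], [2,1,0]),
     (relation7, [1,2,3], [3,1,2,0]), (relation7, [1,2,3], [3,4,2,0]),
     (chain2, [1,2], [2,3,1,0]), (relation8, [1,2,3,0], [3,1,2,4]),
     (relation9, [1,2,3,4], [2,3,4,0])]"

text \<open>
  The symmetries of \<open>B5\<close> and of \<open>A5\<close>: every pattern placed by \<open>patterns_B\<close> or \<open>patterns_A\<close>
  represents its whole orbit.
\<close>

definition symmetries_B :: "(bool \<times> nat list \<times> nat list) list" where
  "symmetries_B =
    [(False, [0,1,2,3,4], [0,1,2,3,4]), (False, [1,0,2,4,3], [0,3,4,1,2]),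
     (True, [1,3,0,2,4], [2,0,3,1,4]), (True, [3,1,0,4,2], [2,1,4,0,3])]"

definition symmetries_A :: "(bool \<times> nat list \<times> nat list) list" where
  "symmetries_A = [(t, 0 # p, 0 # p). t \<leftarrow> [False, True],
     p \<leftarrow> filter distinct (product_lists [[1,2,3,4],[1,2,3,4],[1,2,3,4],[1,2,3,4]])]"

lemmas pattern_defs = relation5_def relation6_def relation7_def relation7'_def relation8_def
  relation9_def chain1_def chain2_def pattern_S_def

lemma edges_in_grid:
  "edges relation5 \<subseteq> Pow (grid 2 3)" "edges relation6 \<subseteq> Pow (grid 3 3)"
  "edges relation7 \<subseteq> Pow (grid 3 4)" "edges relation7' \<subseteq> Pow (grid 3 4)"
  "edges relation8 \<subseteq> Pow (grid 4 4)" "edges relation9 \<subseteq> Pow (grid 4 4)"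
  "edges chain1 \<subseteq> Pow (grid 2 3)" "edges chain2 \<subseteq> Pow (grid 2 4)"
  "edges pattern_S \<subseteq> Pow (grid 3 3)"
  by (auto simp: pattern_defs grid_def)

lemmas reducible_patterns = reducible_relation5 reducible_relation6 reducible_relation7
  reducible_relation7' reducible_relation8 reducible_relation9 reducible_chain1 reducible_chain2
  reducible_pattern_S

interpretation B: placed_patterns patterns_B symmetries_B 5
proof
  show "list_all (\<lambda>(t, rs, cs). injection 5 rs \<and> injection 5 cs \<and> length rs = 5 \<and> length cs = 5)
      symmetries_B"
    by code_simp
  show "\<forall>(p, rs, cs)\<in>set patterns_B. injection 5 rs \<and> injection 5 cs \<and>
      edges p \<subseteq> Pow (grid (length rs) (length cs))"
    by (simp add: patterns_B_def injection_def edges_in_grid [unfolded nat_numerals])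
qed

interpretation A: placed_patterns patterns_A symmetries_A 5
proof
  show "list_all (\<lambda>(t, rs, cs). injection 5 rs \<and> injection 5 cs \<and> length rs = 5 \<and> length cs = 5)
      symmetries_A"
    by code_simp
  show "\<forall>(p, rs, cs)\<in>set patterns_A. injection 5 rs \<and> injection 5 cs \<and>
      edges p \<subseteq> Pow (grid (length rs) (length cs))"
    by (simp add: patterns_A_def injection_def edges_in_grid [unfolded nat_numerals])
qed

lemma reducible_patterns_B:
  "(p, rs, cs) \<in> set patterns_B \<Longrightarrow> reducible_config (length rs) (length cs) {} (edges p)"
  by (auto simp: patterns_B_def reducible_patterns [unfolded nat_numerals])

lemma reducible_patterns_A:
  "(p, rs, cs) \<in> set patterns_A \<Longrightarrow> reducible_config (length rs) (length cs) {} (edges p)"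
  by (auto simp: patterns_A_def reducible_patterns [unfolded nat_numerals])

text \<open>The chains overload a strip, and all other patterns in \<open>patterns_A\<close> carry a
  product relation.\<close>

lemma excluded_patterns_A:
  "(p, rs, cs) \<in> set patterns_A \<Longrightarrow>
    strip_overload (length rs) (length cs) {} (edges p) \<or> product_relation {} (edges p)"
  by (auto simp: patterns_A_def strip_overload_chain1 [unfolded nat_numerals]
      strip_overload_chain2 [unfolded nat_numerals]
      product_relation_relation5 product_relation_relation7 product_relation_relation8
      product_relation_relation9)

definition cells_A :: "cell list" where
  "cells_A = [(0,1),(0,2),(0,3),(0,4),(1,0),(2,0),(3,0),(4,0),(1,1),(2,2),(3,3),(4,4)]"

definition cells_B :: "cell list" where
  "cells_B = [(0,0),(0,1),(0,2),(1,0),(1,3),(1,4),(2,1),(2,3),(3,1),(3,4),(4,2),(4,3)]"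

lemma A5_eq: "A5 = set cells_A"
proof -
  have "{1..4::nat} = {1, 2, 3, 4}"
    by auto
  then show ?thesis
    by (auto simp: A5_def cells_A_def)
qed

lemma B5_eq: "B5 = set cells_B"
  by (simp add: B5_def cells_B_def)

text \<open>The exceptional matchings enter the search as further lists to be hit.\<close>

definition F_lists :: "(cell \<times> cell) list list" where
  "F_lists =
    [[((1,2),(3,4)), ((1,3),(4,2)), ((1,4),(2,3)), ((2,1),(4,3)), ((2,4),(3,1)), ((3,2),(4,1))],
     [((1,2),(4,3)), ((1,3),(2,4)), ((1,4),(3,2)), ((2,1),(3,4)), ((2,3),(4,1)), ((3,1),(4,2))]]"

text \<open>Six disjoint two-edges leave one of the 13 free cells uncovered, hence
  \<open>k = 1\<close>. Each level removes at least one cell, so depth 13 is enough.\<close>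

lemma hits_all_B:
  "hits_all 13 (1, free_cells B5, map two_edges (placements patterns_B symmetries_B))"
  unfolding B5_eq by code_simp

lemma hits_all_A:
  "hits_all 13 (1, free_cells A5,
    F_lists @ map two_edges (placements patterns_A symmetries_A))"
  unfolding A5_eq by code_simp

text \<open>Checking every placed pattern takes the place of a proof that the listed symmetries
  preserve \<open>B5\<close>.\<close>

lemma one_edges_in_B: "list_all (one_edges_in B5) (placements patterns_B symmetries_B)"
  unfolding B5_eq by code_simp

lemma one_edges_in_A: "list_all (one_edges_in A5) (placements patterns_A symmetries_A)"
  unfolding A5_eq by code_simp

lemma length_free_cells: "length (free_cells A5) = 13" "length (free_cells B5) = 13"
  unfolding A5_eq B5_eq by code_simp+

lemma card_F: "card F_plus = 6" "card F_minus = 6"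
  by (simp_all add: F_plus_def F_minus_def doubleton_eq_iff)

section \<open>From the search to the two claims\<close>

lemma reducible_B:
  assumes "simple_configuration 5 5 B5 K" and "card K = 6"
  shows "reducible_config 5 5 B5 K"
proof -
  have conf: "B5 \<subseteq> grid 5 5" "\<And>e. e \<in> K \<Longrightarrow> e \<subseteq> grid 5 5 \<and> card e = 2"
    and disj: "disjoint (selected_edges B5 K)"
    using assms(1) by (auto simp: simple_configuration_def configuration_def)
  \<comment> \<open>A two-edge meeting \<open>B5\<close> would share a cell with a singleton edge
    and, by disjointness, equal it.\<close>
  have "e \<inter> B5 = {}" if e: "e \<in> K" for e
  proof (rule ccontr)
    assume "e \<inter> B5 \<noteq> {}"
    then obtain c where c: "c \<in> e" "c \<in> B5"
      by blast
    then have "{c} \<in> selected_edges B5 K" "e \<in> selected_edges B5 K"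
      using e by (auto simp: selected_edges_def)
    then have "{c} = e"
      using disjointD [OF disj] c(1) by blast
    then show False
      using conf(2) [OF e] by auto
  qed
  then have K: "e \<subseteq> set (free_cells B5) \<and> card e = 2" if "e \<in> K" for e
    using conf(2) [OF that] that by (auto simp: set_free_cells)
  have "disjoint K"
    using disj unfolding selected_edges_def by (rule disjoint_unionD2)
  with hits_all_sound [OF hits_all_B distinct_free_cells K, of K] obtain p
    where p: "p \<in> set (placements patterns_B symmetries_B)"
      "\<forall>(a, b)\<in>set (two_edges p). {a, b} \<in> K"
    using assms(2) length_free_cells by auto
  show ?thesis
  proof (rule reducible_config_mono [OF B.reducible_placement [OF p(1) reducible_patterns_B]])
    show "edges p \<subseteq> selected_edges B5 K"
      using p one_edges_in_B by (intro edges_subset_selected) (auto simp: list_all_iff)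
    show "finite B5" "finite K"
      using assms(2) conf(1) by (auto intro: finite_subset card_ge_0_finite)
    show "selected_edges B5 K \<subseteq> Pow (grid 5 5)"
      using conf by (auto simp: selected_edges_def)
  qed
qed

lemma excluded_A:
  assumes K: "\<And>e. e \<in> K \<Longrightarrow> e \<subseteq> grid 5 5 - A5 \<and> card e = 2"
    and card: "card K = 6" and disj: "disjoint K" and ne: "K \<noteq> F_plus" "K \<noteq> F_minus"
  shows "excluded 5 5 A5 K \<and> reducible_config 5 5 A5 K"
proof -
  have A5: "A5 \<subseteq> grid 5 5"
    by (auto simp: A5_def grid_def)
  have fin: "finite A5" "finite K"
    using card A5 by (auto intro: finite_subset card_ge_0_finite)
  have K': "e \<subseteq> set (free_cells A5) \<and> card e = 2" if "e \<in> K" for e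
    using K [OF that] by (auto simp: set_free_cells)
  \<comment> \<open>All three sets have six elements, so containment would be equality.\<close>
  have not_F: "\<not> F_plus \<subseteq> K" "\<not> F_minus \<subseteq> K"
    using card_subset_eq [OF fin(2)] card card_F ne by metis+
  obtain T where T: "T \<in> set F_lists \<union> two_edges ` set (placements patterns_A symmetries_A)"
      "\<forall>(a, b)\<in>set T. {a, b} \<in> K"
    using hits_all_sound [OF hits_all_A distinct_free_cells K' disj] card length_free_cells by auto
  moreover have "T \<notin> set F_lists"
    using T(2) not_F by (auto simp: F_lists_def F_plus_def F_minus_def)
  ultimately obtain p where p: "p \<in> set (placements patterns_A symmetries_A)"
      "\<forall>(a, b)\<in>set (two_edges p). {a, b} \<in> K"
    by auto
  have sub: "edges p \<subseteq> selected_edges A5 K"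
    using p one_edges_in_A by (intro edges_subset_selected) (auto simp: list_all_iff)
  have grid: "selected_edges A5 K \<subseteq> Pow (grid 5 5)"
    using A5 K by (auto simp: selected_edges_def)
  show ?thesis
    using A.excluded_placement [OF p(1) excluded_patterns_A] strip_overload_mono [OF _ sub fin]
      product_relation_mono [OF _ sub fin]
      reducible_config_mono [OF A.reducible_placement [OF p(1) reducible_patterns_A] sub fin grid]
    by (auto simp: excluded_def)
qed

theorem lemma5p2:
  shows "(\<not> (\<exists>E2. simple_configuration 5 5 B5 E2 \<and> card E2 = 6 \<and> irreducible_config 5 5 B5 E2)) \<and>
         (\<forall>K. (\<forall>e\<in>K. e \<subseteq> grid 5 5 - A5 \<and> card e = 2) \<and> card K = 6 \<and> disjoint K \<and>
              K \<noteq> F_plus \<and> K \<noteq> F_minus \<longrightarrow>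
            excluded 5 5 A5 K \<and> reducible_config 5 5 A5 K)"
  using reducible_B excluded_A unfolding irreducible_config_def by blast

end
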